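(* Let $\alpha\in\mathbb{R}$ and put $\beta=-3\alpha$. Let $c_1,c_2\in\mathbb{R}$, $m\ge 0$ and $r_*>0$ be constants such that $N^2(r)\doteq c_1-\frac{m}{r}+c_2 r$ is positive for all $r>r_*$, and such that the static spherically symmetric exterior metric $$\overset{\circ}{\bar g}=-N^2(r)\,dt^2+\frac{1}{N^2(r)}\,dr^2+r^2 g_{\mathbb{S}^2}\qquad\text{on}\qquad \overset{\circ}{V}=\mathbb{R}\times(r_*,\infty)\times\mathbb{S}^2$$ is $A$-flat, i.e. satisfies $A_{\overset{\circ}{\bar g}}=0$ for the parameters $(\alpha,\beta)=(\alpha,-3\alpha)$. Then the fourth order energy of $(\overset{\circ}{V},\overset{\circ}{\bar g})$, computed in the rectangular coordinates $x=r\theta$ ($r>r_*$, $\theta\in\mathbb{S}^2\subset\mathbb{R}^3$), is well-defined (the defining limit exists) and $$\mathcal{E}_{\alpha,-3\alpha}(\overset{\circ}{\bar g})=8\pi\alpha c_2 .$$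
   Context: For a Lorentzian metric $\bar g$ and real parameters $\alpha,\beta$ let $$A_{\bar g}=\beta\Box_{\bar g}\mathrm{Ric}_{\bar g}+\left(\tfrac12\beta+2\alpha\right)\Box_{\bar g}R_{\bar g}\,\bar g-(2\alpha+\beta)\bar\nabla^2R_{\bar g}+2\beta\,\mathrm{Ric}_{\bar g}\cdot\mathrm{Riem}_{\bar g}+2\alpha R_{\bar g}\mathrm{Ric}_{\bar g}-\tfrac12\alpha R_{\bar g}^2\,\bar g-\tfrac12\beta\langle\mathrm{Ric}_{\bar g},\mathrm{Ric}_{\bar g}\rangle_{\bar g}\,\bar g,$$ where $\Box_{\bar g}=\bar g^{\mu\nu}\bar\nabla_\mu\bar\nabla_\nu$, $(\mathrm{Ric}\cdot\mathrm{Riem})_{\mu\nu}=\mathrm{Riem}^{\tau}{}_{\mu\lambda\nu}\mathrm{Ric}^{\lambda}{}_{\tau}$, $R(X,Y)Z=\nabla_X\nabla_YZ-\nabla_Y\nabla_XZ-\nabla_{[X,Y]}Z$, $R^i{}_{jkl}=dx^i(R(\partial_k,\partial_l)\partial_j)$, $\mathrm{Ric}_{ij}=R^l{}_{ilj}$. This is the $L^2$-gradient of $\int(\alpha R^2+\beta|\mathrm{Ric}|^2)\,dV$. Fourth order energy (space dimension $n$, rectangular end coordinates $x^1,\dots,x^n$ near infinity, repeated spatial indices summed from $1$ to $n$, $S^{n-1}_r$ the coordinate sphere of radius $r$, $\hat\nu^j=x^j/r$, $d\omega_r$ its Euclidean area element): $$\begin{aligned}\mathcal{E}_{\alpha,\beta}(\bar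 g)=\lim_{r\to\infty}\Big\{&\left(\tfrac32\beta+2\alpha\right)\int_{S^{n-1}_r}(\partial_j\partial_i\partial_ig_{aa}-\partial_j\partial_u\partial_ig_{ui})\hat\nu^j d\omega_r+\tfrac{\beta}{2}\int_{S^{n-1}_r}(\partial_i\ddot g_{ji}-\partial_j\ddot g_{ii})\hat\nu^jd\omega_r\\&+\tfrac\beta2\int_{S^{n-1}_r}(\partial_i\partial_j\dot X_i-\partial_i\partial_i\dot X_j)\hat\nu^jd\omega_r+(\beta+2\alpha)\Big(\int_{S^{n-1}_r}\partial_j\partial_i\partial_iN^2\hat\nu^jd\omega_r-\int_{S^{n-1}_r}\partial_j\ddot g_{ii}\hat\nu^jd\omega_r+2\int_{S^{n-1}_r}\partial_j\partial_i\dot X_i\hat\nu^jd\omega_r\Big)\Big\}\end{aligned}$$ whenever the limit exists. Here $g_{ij}=\bar g(\partial_i,\partial_j)$, $X_i=\bar g(\partial_t,\partial_i)$ is the shift, $N$ is the lapse ($\bar g_{tt}=-N^2+|X|_g^2$), everything is evaluated at $t=0$, and $\dot{}$ denotes $\partial_t|_{t=0}$. In the present static case $X=0$ and all time derivatives vanish, and $n=3$. *)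

theory Defs
  imports "HOL-Analysis.Analysis"
begin

section \<open>Tensor calculus in a coordinate chart\<close>

text \<open>
  A tensor field on a chart domain in \<open>real ^ 'i\<close> is the function giving its
  components at each point.
\<close>

definition partial :: "'i::finite \<Rightarrow> (real ^ 'i \<Rightarrow> real) \<Rightarrow> real ^ 'i \<Rightarrow> real" where
  "partial i f p = deriv (\<lambda>s. f (p + s *\<^sub>R axis i 1)) 0"

type_synonym 'i metric = "real ^ 'i \<Rightarrow> real ^ 'i ^ 'i"

definition inv_metric :: "'i::finite metric \<Rightarrow> real ^ 'i \<Rightarrow> 'i \<Rightarrow> 'i \<Rightarrow> real" where
  "inv_metric g p i j = matrix_inv (g p) $ i $ j"

text \<open>\<open>christoffel g k i j\<close> is \<open>\<Gamma>\<^sup>k\<^sub>i\<^sub>j\<close>.\<close>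

definition christoffel :: "'i::finite metric \<Rightarrow> 'i \<Rightarrow> 'i \<Rightarrow> 'i \<Rightarrow> real ^ 'i \<Rightarrow> real" where
  "christoffel g k i j p = (1/2) * (\<Sum>l\<in>UNIV. inv_metric g p k l *
     (partial i (\<lambda>q. g q $ l $ j) p + partial j (\<lambda>q. g q $ l $ i) p
      - partial l (\<lambda>q. g q $ i $ j) p))"

text \<open>
  \<open>riemann g i j k l\<close> is \<open>R\<^sup>i\<^sub>j\<^sub>k\<^sub>l = dx\<^sup>i(R(\<partial>\<^sub>k,\<partial>\<^sub>l)\<partial>\<^sub>j)\<close>, where
  \<open>R(X,Y)Z = \<nabla>\<^sub>X\<nabla>\<^sub>YZ - \<nabla>\<^sub>Y\<nabla>\<^sub>XZ - \<nabla>\<^sub>[\<^sub>X\<^sub>,\<^sub>Y\<^sub>]Z\<close>; here \<open>\<nabla>\<^sub>l \<partial>\<^sub>j = \<Gamma>\<^sup>m\<^sub>l\<^sub>j \<partial>\<^sub>m\<close>.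
\<close>

definition riemann :: "'i::finite metric \<Rightarrow> 'i \<Rightarrow> 'i \<Rightarrow> 'i \<Rightarrow> 'i \<Rightarrow> real ^ 'i \<Rightarrow> real" where
  "riemann g i j k l p =
     partial k (christoffel g i l j) p - partial l (christoffel g i k j) p
     + (\<Sum>m\<in>UNIV. christoffel g i k m p * christoffel g m l j p
                 - christoffel g i l m p * christoffel g m k j p)"

definition ricci :: "'i::finite metric \<Rightarrow> 'i \<Rightarrow> 'i \<Rightarrow> real ^ 'i \<Rightarrow> real" where
  "ricci g i j p = (\<Sum>l\<in>UNIV. riemann g l i l j p)"

definition scalar_curvature :: "'i::finite metric \<Rightarrow> real ^ 'i \<Rightarrow> real" where
  "scalar_curvature g p = (\<Sum>i\<in>UNIV. \<Sum>j\<in>UNIV. inv_metric g p i j * ricci g i j p)"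

text \<open>
  Covariant derivatives of covariant tensors of rank 1, 2, 3; the index of
  differentiation comes first.
\<close>

definition cov1 :: "'i::finite metric \<Rightarrow> ('i \<Rightarrow> real ^ 'i \<Rightarrow> real)
    \<Rightarrow> 'i \<Rightarrow> 'i \<Rightarrow> real ^ 'i \<Rightarrow> real" where
  "cov1 g T k i p = partial k (T i) p - (\<Sum>m\<in>UNIV. christoffel g m k i p * T m p)"

definition cov2 :: "'i::finite metric \<Rightarrow> ('i \<Rightarrow> 'i \<Rightarrow> real ^ 'i \<Rightarrow> real)
    \<Rightarrow> 'i \<Rightarrow> 'i \<Rightarrow> 'i \<Rightarrow> real ^ 'i \<Rightarrow> real" where
  "cov2 g T k i j p = partial k (T i j) p
     - (\<Sum>m\<in>UNIV. christoffel g m k i p * T m j p)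
     - (\<Sum>m\<in>UNIV. christoffel g m k j p * T i m p)"

definition cov3 :: "'i::finite metric \<Rightarrow> ('i \<Rightarrow> 'i \<Rightarrow> 'i \<Rightarrow> real ^ 'i \<Rightarrow> real)
    \<Rightarrow> 'i \<Rightarrow> 'i \<Rightarrow> 'i \<Rightarrow> 'i \<Rightarrow> real ^ 'i \<Rightarrow> real" where
  "cov3 g T k h i j p = partial k (T h i j) p
     - (\<Sum>m\<in>UNIV. christoffel g m k h p * T m i j p)
     - (\<Sum>m\<in>UNIV. christoffel g m k i p * T h m j p)
     - (\<Sum>m\<in>UNIV. christoffel g m k j p * T h i m p)"

definition hessian :: "'i::finite metric \<Rightarrow> (real ^ 'i \<Rightarrow> real) \<Rightarrow> 'i \<Rightarrow> 'i \<Rightarrow> real ^ 'i \<Rightarrow> real" where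
  "hessian g f = cov1 g (\<lambda>i. partial i f)"

definition box_scalar :: "'i::finite metric \<Rightarrow> (real ^ 'i \<Rightarrow> real) \<Rightarrow> real ^ 'i \<Rightarrow> real" where
  "box_scalar g f p = (\<Sum>k\<in>UNIV. \<Sum>l\<in>UNIV. inv_metric g p k l * hessian g f k l p)"

definition box_tensor2 :: "'i::finite metric \<Rightarrow> ('i \<Rightarrow> 'i \<Rightarrow> real ^ 'i \<Rightarrow> real)
    \<Rightarrow> 'i \<Rightarrow> 'i \<Rightarrow> real ^ 'i \<Rightarrow> real" where
  "box_tensor2 g T i j p =
     (\<Sum>k\<in>UNIV. \<Sum>l\<in>UNIV. inv_metric g p k l * cov3 g (cov2 g T) k l i j p)"

definition ricci_up :: "'i::finite metric \<Rightarrow> 'i \<Rightarrow> 'i \<Rightarrow> real ^ 'i \<Rightarrow> real" where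
  "ricci_up g l t p = (\<Sum>s\<in>UNIV. inv_metric g p l s * ricci g s t p)"

definition ric_riem :: "'i::finite metric \<Rightarrow> 'i \<Rightarrow> 'i \<Rightarrow> real ^ 'i \<Rightarrow> real" where
  "ric_riem g i j p = (\<Sum>t\<in>UNIV. \<Sum>l\<in>UNIV. riemann g t i l j p * ricci_up g l t p)"

definition ricci_norm_sq :: "'i::finite metric \<Rightarrow> real ^ 'i \<Rightarrow> real" where
  "ricci_norm_sq g p = (\<Sum>i\<in>UNIV. \<Sum>j\<in>UNIV. \<Sum>k\<in>UNIV. \<Sum>l\<in>UNIV.
     inv_metric g p i k * inv_metric g p j l * ricci g i j p * ricci g k l p)"

definition A_tensor :: "real \<Rightarrow> real \<Rightarrow> 'i::finite metric \<Rightarrow> 'i \<Rightarrow> 'i \<Rightarrow> real ^ 'i \<Rightarrow> real" where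
  "A_tensor \<alpha> \<beta> g i j p =
       \<beta> * box_tensor2 g (ricci g) i j p
     + (\<beta> / 2 + 2 * \<alpha>) * box_scalar g (scalar_curvature g) p * g p $ i $ j
     - (2 * \<alpha> + \<beta>) * hessian g (scalar_curvature g) i j p
     + 2 * \<beta> * ric_riem g i j p
     + 2 * \<alpha> * scalar_curvature g p * ricci g i j p
     - \<alpha> / 2 * (scalar_curvature g p)\<^sup>2 * g p $ i $ j
     - \<beta> / 2 * ricci_norm_sq g p * g p $ i $ j"

definition A_flat_on :: "real \<Rightarrow> real \<Rightarrow> (real ^ 'i::finite) set \<Rightarrow> 'i metric \<Rightarrow> bool" where
  "A_flat_on \<alpha> \<beta> V g \<longleftrightarrow> (\<forall>p\<in>V. \<forall>i j. A_tensor \<alpha> \<beta> g i j p = 0)"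


section \<open>Fourth order energy of a metric on 3+1 dimensional space-time\<close>

text \<open>
  Space-time coordinates \<open>(t, x\<^sup>1, x\<^sup>2, x\<^sup>3)\<close> are indexed by \<open>3 option\<close>: the index
  \<open>None\<close> is \<open>t\<close> and \<open>Some i\<close> is \<open>x\<^sup>i\<close>.
\<close>

type_synonym spacetime = "real ^ (3 option)"
type_synonym spacetime_metric = "(3 option) metric"

abbreviation dt :: "(spacetime \<Rightarrow> real) \<Rightarrow> spacetime \<Rightarrow> real" where
  "dt \<equiv> partial None"

abbreviation dx :: "3 \<Rightarrow> (spacetime \<Rightarrow> real) \<Rightarrow> spacetime \<Rightarrow> real" where
  "dx i \<equiv> partial (Some i)"

definition spatial_metric :: "spacetime_metric \<Rightarrow> 3 \<Rightarrow> 3 \<Rightarrow> spacetime \<Rightarrow> real" where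
  "spatial_metric G i j p = G p $ Some i $ Some j"

definition shift :: "spacetime_metric \<Rightarrow> 3 \<Rightarrow> spacetime \<Rightarrow> real" where
  "shift G i p = G p $ None $ Some i"

text \<open>The square of the lapse, solved from \<open>G\<^sub>t\<^sub>t = - N\<^sup>2 + |X|\<^sup>2\<close>.\<close>

definition lapse_sq :: "spacetime_metric \<Rightarrow> spacetime \<Rightarrow> real" where
  "lapse_sq G p =
     (let h = matrix_inv (\<chi> i j. spatial_metric G i j p)
      in (\<Sum>i\<in>UNIV. \<Sum>j\<in>UNIV. h $ i $ j * shift G i p * shift G j p)) - G p $ None $ None"

definition at_time_zero :: "real ^ 3 \<Rightarrow> spacetime" where
  "at_time_zero x = (\<chi> \<mu>. case \<mu> of None \<Rightarrow> 0 | Some i \<Rightarrow> x $ i)"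

text \<open>
  Spherical coordinates on the sphere of radius \<open>r\<close>: polar angle \<open>s \<in> [0, pi]\<close> and
  azimuth \<open>u \<in> [0, 2 pi]\<close>; the Euclidean area element is \<open>r\<^sup>2 sin s ds du\<close>.
\<close>

definition sphere_point :: "real \<Rightarrow> real \<times> real \<Rightarrow> real ^ 3" where
  "sphere_point r = (\<lambda>(s, u). vector [r * sin s * cos u, r * sin s * sin u, r * cos s])"

definition flux_integrand :: "(3 \<Rightarrow> spacetime \<Rightarrow> real) \<Rightarrow> real \<Rightarrow> real \<times> real \<Rightarrow> real" where
  "flux_integrand J r a =
     (let x = sphere_point r a
      in (\<Sum>j\<in>UNIV. J j (at_time_zero x) * (x $ j / r)) * (r\<^sup>2 * sin (fst a)))"

definition flux_integrable :: "(3 \<Rightarrow> spacetime \<Rightarrow> real) \<Rightarrow> real \<Rightarrow> bool" where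
  "flux_integrable J r \<longleftrightarrow> set_integrable lborel ({0..pi} \<times> {0..2 * pi}) (flux_integrand J r)"

definition flux :: "(3 \<Rightarrow> spacetime \<Rightarrow> real) \<Rightarrow> real \<Rightarrow> real" where
  "flux J r = set_lebesgue_integral lborel ({0..pi} \<times> {0..2 * pi}) (flux_integrand J r)"

text \<open>The six densities whose fluxes make up the energy, in order of appearance.\<close>

definition density1 :: "spacetime_metric \<Rightarrow> 3 \<Rightarrow> spacetime \<Rightarrow> real" where
  "density1 G j p =
     (\<Sum>i\<in>UNIV. \<Sum>a\<in>UNIV. dx j (dx i (dx i (spatial_metric G a a))) p)
     - (\<Sum>u\<in>UNIV. \<Sum>i\<in>UNIV. dx j (dx u (dx i (spatial_metric G u i))) p)"

definition density2 :: "spacetime_metric \<Rightarrow> 3 \<Rightarrow> spacetime \<Rightarrow> real" where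
  "density2 G j p = (\<Sum>i\<in>UNIV. dx i (dt (dt (spatial_metric G j i))) p
                            - dx j (dt (dt (spatial_metric G i i))) p)"

definition density3 :: "spacetime_metric \<Rightarrow> 3 \<Rightarrow> spacetime \<Rightarrow> real" where
  "density3 G j p = (\<Sum>i\<in>UNIV. dx i (dx j (dt (shift G i))) p - dx i (dx i (dt (shift G j))) p)"

definition density4 :: "spacetime_metric \<Rightarrow> 3 \<Rightarrow> spacetime \<Rightarrow> real" where
  "density4 G j p = (\<Sum>i\<in>UNIV. dx j (dx i (dx i (lapse_sq G))) p)"

definition density5 :: "spacetime_metric \<Rightarrow> 3 \<Rightarrow> spacetime \<Rightarrow> real" where
  "density5 G j p = (\<Sum>i\<in>UNIV. dx j (dt (dt (spatial_metric G i i))) p)"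

definition density6 :: "spacetime_metric \<Rightarrow> 3 \<Rightarrow> spacetime \<Rightarrow> real" where
  "density6 G j p = (\<Sum>i\<in>UNIV. dx j (dx i (dt (shift G i))) p)"

definition energy_at_radius :: "real \<Rightarrow> real \<Rightarrow> spacetime_metric \<Rightarrow> real \<Rightarrow> real" where
  "energy_at_radius \<alpha> \<beta> G r =
       (3/2 * \<beta> + 2 * \<alpha>) * flux (density1 G) r
     + \<beta> / 2 * flux (density2 G) r
     + \<beta> / 2 * flux (density3 G) r
     + (\<beta> + 2 * \<alpha>) * (flux (density4 G) r - flux (density5 G) r + 2 * flux (density6 G) r)"

text \<open>
  The energy is well-defined if all the surface integrals exist for large radii and
  their combination converges; otherwise \<open>energy\<close> has no meaning.
\<close>

definition energy_well_defined :: "real \<Rightarrow> real \<Rightarrow> spacetime_metric \<Rightarrow> bool" where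
  "energy_well_defined \<alpha> \<beta> G \<longleftrightarrow>
     (\<forall>\<^sub>F r in at_top. \<forall>J \<in> {density1 G, density2 G, density3 G, density4 G, density5 G, density6 G}.
        flux_integrable J r) \<and>
     (\<exists>L. (energy_at_radius \<alpha> \<beta> G \<longlongrightarrow> L) at_top)"

definition energy :: "real \<Rightarrow> real \<Rightarrow> spacetime_metric \<Rightarrow> real" where
  "energy \<alpha> \<beta> G = Lim at_top (energy_at_radius \<alpha> \<beta> G)"


section \<open>Static spherically symmetric metrics in rectangular coordinates\<close>

definition space_part :: "spacetime \<Rightarrow> real ^ 3" where
  "space_part p = (\<chi> i. p $ Some i)"

definition time_coord :: "spacetime \<Rightarrow> real" where
  "time_coord p = p $ None"

definition radius :: "spacetime \<Rightarrow> real" where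
  "radius p = norm (space_part p)"

definition angle :: "spacetime \<Rightarrow> real ^ 3" where
  "angle p = sgn (space_part p)"

text \<open>
  The diffeomorphism \<open>(t, r, \<theta>) \<mapsto> (t, r \<theta>)\<close> identifies \<open>\<real> \<times> (r\<^sub>*, \<infinity>) \<times> S\<^sup>2\<close> with the
  following set; its inverse is given by \<open>time_coord\<close>, \<open>radius\<close>, \<open>angle\<close>.
\<close>

definition exterior_region :: "real \<Rightarrow> spacetime set" where
  "exterior_region rs = {p. radius p > rs}"

text \<open>
  Components of \<open>- N\<^sup>2 dt\<^sup>2 + N\<^sup>-\<^sup>2 dr\<^sup>2 + r\<^sup>2 g\<^sub>S\<^sup>2\<close> along the rectangular coordinate fields;
  the argument \<open>N2\<close> is the function \<open>N\<^sup>2\<close> of \<open>r\<close>. The round metric is induced from the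
  Euclidean one, hence is the sum of the squares of the \<open>d\<theta>\<^sup>a\<close>.
\<close>

definition static_metric :: "(real \<Rightarrow> real) \<Rightarrow> spacetime_metric" where
  "static_metric N2 p = (\<chi> \<mu> \<nu>.
     - N2 (radius p) * partial \<mu> time_coord p * partial \<nu> time_coord p
     + 1 / N2 (radius p) * partial \<mu> radius p * partial \<nu> radius p
     + (radius p)\<^sup>2 * (\<Sum>a\<in>UNIV. partial \<mu> (\<lambda>q. angle q $ a) p * partial \<nu> (\<lambda>q. angle q $ a) p))"

end

theory Submission
  imports Defs "HOL-Real_Asymp.Real_Asymp"
begin

text \<open>
  In rectangular coordinates the spatial metric is
  \<open>g\<^sub>i\<^sub>j = \<delta>\<^sub>i\<^sub>j + f(r) x\<^sub>i x\<^sub>j / r\<^sup>2\<close> with \<open>f = 1/N\<^sup>2 - 1\<close>, the shift vanishes and nothing depends on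
  time (\<open>spatial_static_metric\<close>, \<open>shift_static_metric\<close>, \<open>lapse_sq_static_metric\<close>). Hence the four
  densities containing time derivatives vanish, and the energy reduces to the flux of
  \<open>\<partial>\<^sub>j (\<partial>\<^sub>i \<partial>\<^sub>i g\<^sub>a\<^sub>a - \<partial>\<^sub>u \<partial>\<^sub>i g\<^sub>u\<^sub>i)\<close> with weight \<open>3/2 \<beta> + 2 \<alpha> = -5/2 \<alpha>\<close>, plus the flux of \<open>\<partial>\<^sub>j \<Delta> N\<^sup>2\<close>
  with weight \<open>\<beta> + 2 \<alpha> = -\<alpha>\<close>. Both are gradients of radial functions, so each flux is \<open>4 \<pi> r\<^sup>2\<close>
  times a radial derivative (\<open>flux_radial\<close>).

  The lapse produces the whole energy: \<open>1/r\<close> is harmonic, so \<open>\<Delta> N\<^sup>2 = 2 c\<^sub>2 / r\<close>, and its gradient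
  has flux \<open>-8 \<pi> c\<^sub>2\<close> through every sphere. The metric term contributes nothing in the limit.
  Indeed \<open>\<Delta> (f + 3) - div div (f x x\<^sup>T / r\<^sup>2) = - 2 f'/r - 2 f/r\<^sup>2\<close>, which yields the flux
  \<open>4 \<pi> (4 f / r - 2 r f'')\<close>. This tends to 0 as soon as \<open>N\<^sup>2\<close> is bounded away from 0 at infinity,
  and positivity of \<open>N\<^sup>2\<close> together with \<open>m \<ge> 0\<close> forces exactly that: either \<open>c\<^sub>2 > 0\<close>, or
  \<open>c\<^sub>2 = 0\<close> and \<open>c\<^sub>1 > 0\<close> (\<open>positive_lapse_parameters\<close>, \<open>flux_density1_limit\<close>).

  Derivatives of radial functions are organised by the operator \<open>D \<phi> = \<phi>'/r\<close>, which satisfies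
  \<open>\<partial>\<^sub>k (\<phi>(r)) = (D \<phi>)(r) x\<^sub>k\<close>: third derivatives of \<open>\<phi>(r) x\<^sub>a x\<^sub>b\<close> then stay polynomial in \<open>x\<close>, and
  contractions are polynomial identities modulo \<open>r\<^sup>2 = x\<^sub>1\<^sup>2 + x\<^sub>2\<^sup>2 + x\<^sub>3\<^sup>2\<close>.
\<close>

section \<open>Partial derivatives on the exterior region\<close>

text \<open>
  A relational form of \<open>partial\<close>. It also records that the derivative exists, which is what
  sums and products of partial derivatives require; \<open>deriv\<close> is arbitrary where it does not.
\<close>

definition has_partial :: "'i::finite \<Rightarrow> (real ^ 'i \<Rightarrow> real) \<Rightarrow> real \<Rightarrow> real ^ 'i \<Rightarrow> bool" where
  "has_partial i f d p \<longleftrightarrow> ((\<lambda>s. f (p + s *\<^sub>R axis i 1)) has_real_derivative d) (at 0)"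

lemma has_partial_imp_partial: "has_partial i f d p \<Longrightarrow> partial i f p = d"
  unfolding has_partial_def partial_def by (rule DERIV_imp_deriv)

lemma has_partial_unique: "has_partial i f d p \<Longrightarrow> has_partial i f e p \<Longrightarrow> d = e"
  using has_partial_imp_partial by blast

lemma has_partial_sum:
  "(\<And>a. a \<in> A \<Longrightarrow> has_partial i (f a) (d a) p) \<Longrightarrow>
   has_partial i (\<lambda>q. \<Sum>a\<in>A. f a q) (\<Sum>a\<in>A. d a) p"
  unfolding has_partial_def by (rule DERIV_sum)

lemma has_partial_minus:
  "has_partial i f d p \<Longrightarrow> has_partial i g e p \<Longrightarrow> has_partial i (\<lambda>q. f q - g q) (d - e) p"
  unfolding has_partial_def by (rule DERIV_diff)

lemma eventually_on_line:
  assumes "open U" and "p \<in> U"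
  shows "\<forall>\<^sub>F s in nhds 0. p + s *\<^sub>R axis i (1::real) \<in> U"
proof -
  have "((\<lambda>s::real. p + s *\<^sub>R axis i 1) \<longlongrightarrow> p + 0 *\<^sub>R axis i 1) (nhds 0)"
    by (intro tendsto_intros filterlim_ident)
  then show ?thesis
    using topological_tendstoD[OF _ assms(1)] assms(2) by simp
qed

text \<open>
  The metric components have closed formulas only on the exterior region; openness is what
  allows substituting them under iterated partial derivatives.
\<close>

lemma has_partial_cong_open:
  assumes "open U" and "p \<in> U" and "\<And>q. q \<in> U \<Longrightarrow> f q = g q" and "has_partial i g d p"
  shows "has_partial i f d p"
proof -
  have "\<forall>\<^sub>F s in nhds 0. f (p + s *\<^sub>R axis i 1) = g (p + s *\<^sub>R axis i 1)"
    using eventually_on_line[OF assms(1,2)] by eventually_elim (rule assms(3))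
  then show ?thesis
    using assms(4) unfolding has_partial_def by (subst DERIV_cong_ev[OF refl _ refl])
qed

lemma partial_cong_open:
  assumes "open U" and "p \<in> U" and "\<And>q. q \<in> U \<Longrightarrow> f q = g q"
  shows "partial i f p = partial i g p"
  unfolding partial_def
  by (rule deriv_cong_ev[OF _ refl])
    (use eventually_on_line[OF assms(1,2)] in eventually_elim, rule assms(3))

lemma radius_alt: "radius p = sqrt (\<Sum>a\<in>UNIV. (p $ Some a)\<^sup>2)"
  by (simp add: radius_def space_part_def norm_vec_def L2_set_def)

lemma radius_sq: "(radius p)\<^sup>2 = (\<Sum>a\<in>UNIV. (p $ Some a)\<^sup>2)"
  by (simp add: radius_alt sum_nonneg)

lemma open_exterior_region: "open (exterior_region rs)"
proof -
  have "continuous_on UNIV radius"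
    unfolding radius_alt [abs_def] by (intro continuous_intros)
  then show ?thesis
    unfolding exterior_region_def by (simp add: open_Collect_less)
qed

lemma coordinate_on_line: "(p + s *\<^sub>R axis k (1::real)) $ i = p $ i + (if i = k then s else 0)"
  by (simp add: axis_def)

lemma has_partial_coordinate: "has_partial k (\<lambda>q. q $ i) (if i = k then 1 else 0) p"
  unfolding has_partial_def coordinate_on_line by (auto intro!: derivative_eq_intros)

lemma has_partial_radius:
  assumes "radius p > 0"
  shows "has_partial (Some k) radius (p $ Some k / radius p) p"
proof -
  have pos: "(\<Sum>a\<in>UNIV. (p $ Some a)\<^sup>2) > 0"
    using assms by (simp flip: radius_sq)
  have "((\<lambda>s. \<Sum>a\<in>UNIV. (p $ Some a + (if a = k then s else 0))\<^sup>2)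
      has_real_derivative (\<Sum>a\<in>UNIV. 2 * p $ Some a * (if a = k then 1 else 0))) (at 0)"
    by (rule DERIV_sum) (auto intro!: derivative_eq_intros)
  from DERIV_chain2[OF DERIV_real_sqrt this]
  have "((\<lambda>s. sqrt (\<Sum>a\<in>UNIV. (p $ Some a + (if a = k then s else 0))\<^sup>2))
      has_real_derivative p $ Some k / radius p) (at 0)"
    using pos by (simp add: radius_alt if_distrib if_distribR field_simps cong: if_cong)
  moreover have "radius (p + s *\<^sub>R axis (Some k) 1)
      = sqrt (\<Sum>a\<in>UNIV. (p $ Some a + (if a = k then s else 0))\<^sup>2)" for s
    by (simp only: radius_alt coordinate_on_line option.inject)
  ultimately show ?thesis
    by (simp only: has_partial_def)
qed

section \<open>Calculus of radial functions\<close>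

text \<open>
  Says that \<open>\<phi>'\<close> is \<open>D \<phi>\<close>, where \<open>D \<phi> (\<rho>)\<close> is the derivative of \<open>\<phi>\<close> divided by \<open>\<rho>\<close>. With
  this normalisation no division appears in the partial derivatives of \<open>\<phi>(r)\<close>.
\<close>

definition radial_chain :: "real \<Rightarrow> (real \<Rightarrow> real) \<Rightarrow> (real \<Rightarrow> real) \<Rightarrow> bool" where
  "radial_chain rs \<phi> \<phi>' \<longleftrightarrow> (\<forall>\<rho>>rs. (\<phi> has_real_derivative \<rho> * \<phi>' \<rho>) (at \<rho>))"

lemma has_partial_radial:
  assumes "radial_chain rs \<phi> \<phi>'" and "0 \<le> rs" and "p \<in> exterior_region rs"
  shows "has_partial (Some k) (\<lambda>q. \<phi> (radius q)) (\<phi>' (radius p) * p $ Some k) p"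
proof -
  have r: "radius p > rs"
    using assms(3) by (simp add: exterior_region_def)
  have "(\<phi> has_real_derivative radius p * \<phi>' (radius p)) (at (radius (p + 0 *\<^sub>R axis (Some k) 1)))"
    using assms(1) r by (simp add: radial_chain_def)
  from DERIV_chain2[OF this has_partial_radius[unfolded has_partial_def]]
  show ?thesis
    using r assms(2) by (simp add: has_partial_def mult.commute)
qed

lemma partial_partial_radial:
  assumes "radial_chain rs \<phi> \<phi>1" and "radial_chain rs \<phi>1 \<phi>2"
    and "0 \<le> rs" and "p \<in> exterior_region rs"
    and f: "\<And>q. q \<in> exterior_region rs \<Longrightarrow> f q = \<phi> (radius q)"
  shows "partial (Some k) (partial (Some l) f) p =
    \<phi>2 (radius p) * p $ Some k * p $ Some l + \<phi>1 (radius p) * (if l = k then 1 else 0)"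
proof -
  have "partial (Some l) f q = \<phi>1 (radius q) * q $ Some l" if "q \<in> exterior_region rs" for q
    by (rule has_partial_imp_partial, rule has_partial_cong_open[OF open_exterior_region that f])
      (use assms that in \<open>auto intro: has_partial_radial\<close>)
  moreover have "has_partial (Some k) (\<lambda>q. \<phi>1 (radius q) * q $ Some l)
      (\<phi>2 (radius p) * p $ Some k * p $ Some l + \<phi>1 (radius p) * (if l = k then 1 else 0)) p"
    using DERIV_mult[OF has_partial_radial[OF assms(2-4), of k, unfolded has_partial_def]
        has_partial_coordinate[of "Some k" "Some l" p, unfolded has_partial_def]]
    by (simp add: has_partial_def algebra_simps)
  ultimately show ?thesis
    by (rule has_partial_imp_partial[OF has_partial_cong_open[OF open_exterior_region assms(4)]])
qed

text \<open>
  The closed form of \<open>\<partial>\<^sub>k \<partial>\<^sub>l (\<phi>(r) x\<^sub>a x\<^sub>b)\<close>, where \<open>\<phi>1 = D \<phi>\<close> and \<open>\<phi>2 = D (D \<phi>)\<close>.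
\<close>

definition radial_hess :: "(real \<Rightarrow> real) \<Rightarrow> (real \<Rightarrow> real) \<Rightarrow> (real \<Rightarrow> real) \<Rightarrow> 3 \<Rightarrow> 3 \<Rightarrow> 3 \<Rightarrow> 3
    \<Rightarrow> spacetime \<Rightarrow> real" where
  "radial_hess \<phi> \<phi>1 \<phi>2 k l a b p =
     (let d = (\<lambda>i j. if i = j then 1 else 0); x = (\<lambda>i. p $ Some i); r = radius p in
      \<phi>2 r * x k * x l * x a * x b
      + \<phi>1 r * (d l k * x a * x b + x l * (d a k * x b + x a * d b k)
                 + x k * (d a l * x b + x a * d b l))
      + \<phi> r * (d a l * d b k + d a k * d b l))"

lemma partial_partial_radial_tensor:
  assumes c: "radial_chain rs \<phi> \<phi>1" "radial_chain rs \<phi>1 \<phi>2"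
    and rs: "0 \<le> rs" and p: "p \<in> exterior_region rs"
    and f: "\<And>q. q \<in> exterior_region rs \<Longrightarrow> f q = c + \<phi> (radius q) * q $ Some a * q $ Some b"
  shows "partial (Some k) (partial (Some l) f) p = radial_hess \<phi> \<phi>1 \<phi>2 k l a b p"
proof -
  define d where "d = (\<lambda>i j::3. if i = j then 1 else 0::real)"
  define P where "P = (\<lambda>q. \<phi>1 (radius q) * q $ Some l * q $ Some a * q $ Some b
    + \<phi> (radius q) * (d a l * q $ Some b + q $ Some a * d b l))"
  have coord: "((\<lambda>s. (q + s *\<^sub>R axis (Some k) 1) $ Some i) has_real_derivative d i k) (at 0)" for k i q
    using has_partial_coordinate[of "Some k" "Some i" q] by (simp add: has_partial_def d_def)
  have ax: "axis (Some k) (1::real) $ Some i = d i k" for i k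
    by (simp add: axis_def d_def)
  note rad = has_partial_radial[OF _ rs, unfolded has_partial_def]
  have "partial (Some l) f q = P q" if q: "q \<in> exterior_region rs" for q
    apply (rule has_partial_imp_partial, rule has_partial_cong_open[OF open_exterior_region q f])
    unfolding has_partial_def P_def
    by (auto intro!: derivative_eq_intros coord rad[OF c(1) q] simp: ax algebra_simps)
  moreover have "has_partial (Some k) P (radial_hess \<phi> \<phi>1 \<phi>2 k l a b p) p"
    unfolding has_partial_def P_def
    by (auto intro!: derivative_eq_intros coord rad[OF c(1) p] rad[OF c(2) p]
        simp: ax radial_hess_def Let_def algebra_simps simp flip: d_def)
  ultimately show ?thesis
    by (rule has_partial_imp_partial[OF has_partial_cong_open[OF open_exterior_region p]])
qed

text \<open>
  Only the existence of the third derivatives matters: it allows moving the outer derivative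
  out of the index sums, after which the contracted Hessian is differentiated instead.
\<close>

lemma has_partial_radial_hess:
  assumes c: "radial_chain rs \<phi> \<phi>1" "radial_chain rs \<phi>1 \<phi>2" "radial_chain rs \<phi>2 \<phi>3"
    and rs: "0 \<le> rs" and p: "p \<in> exterior_region rs"
  shows "has_partial (Some j) (radial_hess \<phi> \<phi>1 \<phi>2 k l a b)
    (partial (Some j) (radial_hess \<phi> \<phi>1 \<phi>2 k l a b) p) p"
proof -
  have coord: "(\<lambda>s. (p + s *\<^sub>R axis (Some j) 1) $ Some i) differentiable (at 0)" for i
    using has_partial_coordinate[of "Some j" "Some i" p]
    by (auto simp: has_partial_def real_differentiable_def)
  note rad = has_partial_radial[OF _ rs p, unfolded has_partial_def, THEN real_differentiable_def[THEN iffD2, OF exI]]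
  have "(\<lambda>s. radial_hess \<phi> \<phi>1 \<phi>2 k l a b (p + s *\<^sub>R axis (Some j) 1)) differentiable (at 0)"
    unfolding radial_hess_def Let_def
    by (intro differentiable_add differentiable_mult differentiable_const coord c[THEN rad])
  then show ?thesis
    unfolding has_partial_def partial_def by (simp add: DERIV_deriv_iff_real_differentiable)
qed

text \<open>
  This is \<open>\<partial>\<^sub>i \<partial>\<^sub>i g\<^sub>a\<^sub>a - \<partial>\<^sub>u \<partial>\<^sub>i g\<^sub>u\<^sub>i\<close> for \<open>g\<^sub>i\<^sub>j = \<delta>\<^sub>i\<^sub>j + \<phi>(r) x\<^sub>i x\<^sub>j\<close>. Both contractions contain
  \<open>r\<^sup>4 \<phi>2\<close>, which cancels; the coefficients of \<open>r\<^sup>2 \<phi>1\<close> are 7 and 9, those of \<open>\<phi>\<close> are 6 and 12.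
\<close>

lemma radial_hess_contraction:
  "(\<Sum>i\<in>UNIV. \<Sum>a\<in>UNIV. radial_hess \<phi> \<phi>1 \<phi>2 i i a a p)
     - (\<Sum>u\<in>UNIV. \<Sum>i\<in>UNIV. radial_hess \<phi> \<phi>1 \<phi>2 u i u i p)
   = - 2 * (radius p)\<^sup>2 * \<phi>1 (radius p) - 6 * \<phi> (radius p)"
  by (simp add: radius_sq sum_3 radial_hess_def Let_def) algebra

section \<open>Fluxes of radial fields through coordinate spheres\<close>

lemma norm_sphere_point:
  assumes "r > 0"
  shows "norm (sphere_point r a) = r"
proof -
  obtain s u where a: "a = (s, u)" by fastforce
  have "(r * sin s * cos u)\<^sup>2 + (r * sin s * sin u)\<^sup>2 + (r * cos s)\<^sup>2
      = r\<^sup>2 * ((sin s)\<^sup>2 * ((sin u)\<^sup>2 + (cos u)\<^sup>2) + (cos s)\<^sup>2)"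
    by (simp only: power_mult_distrib) (simp only: algebra_simps)
  also have "\<dots> = r\<^sup>2" by simp
  finally show ?thesis
    using assms by (simp add: a sphere_point_def norm_vec_def L2_set_def sum_3)
qed

lemma at_time_zero_Some: "at_time_zero x $ Some i = x $ i"
  by (simp add: at_time_zero_def)

lemma radius_at_time_zero: "radius (at_time_zero x) = norm x"
  by (simp add: radius_def space_part_def at_time_zero_Some vec_nth_inverse)

lemma integral_sin_rectangle:
  "set_integrable lborel ({0..pi} \<times> {0..2 * pi}) (\<lambda>a::real \<times> real. C * sin (fst a))"
  "set_lebesgue_integral lborel ({0..pi} \<times> {0..2 * pi}) (\<lambda>a::real \<times> real. C * sin (fst a)) = 4 * pi * C"
proof -
  have cbox: "{0..pi} \<times> {0..2 * pi} = cbox (0::real, 0::real) (pi, 2 * pi)"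
    by (simp add: cbox_Pair_eq)
  have cont: "continuous_on (cbox (0::real, 0::real) (pi, 2 * pi)) (\<lambda>a. C * sin (fst a))"
    by (intro continuous_intros)
  show int: "set_integrable lborel ({0..pi} \<times> {0..2 * pi}) (\<lambda>a::real \<times> real. C * sin (fst a))"
    unfolding cbox set_integrable_def
    using borel_integrable_compact[OF compact_cbox cont] by (simp add: scaleR_conv_of_real indicator_def if_distrib mult.commute cong: if_cong)
  have sin: "(sin has_integral 2) {0..pi}"
  proof -
    have "(sin has_integral (- cos pi - (- cos 0))) {0..pi}"
      by (rule fundamental_theorem_of_calculus)
        (auto intro!: derivative_eq_intros simp flip: has_real_derivative_iff_has_vector_derivative)
    then show ?thesis by simp
  qed
  have "set_lebesgue_integral lborel ({0..pi} \<times> {0..2 * pi}) (\<lambda>a::real \<times> real. C * sin (fst a))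
      = integral ({0..pi} \<times> {0..2 * pi}) (\<lambda>a. C * sin (fst a))"
    using set_borel_integral_eq_integral(2)[OF int] .
  also have "\<dots> = integral (cbox 0 pi) (\<lambda>s. integral (cbox 0 (2 * pi)) (\<lambda>u. C * sin s))"
    unfolding cbox using integral_prod_continuous[OF cont] by simp
  also have "\<dots> = integral {0..pi} (\<lambda>s. (2 * pi * C) * sin s)"
    by (simp add: mult.assoc)
  also have "\<dots> = 4 * pi * C"
    using integral_unique[OF sin] by simp
  finally show "set_lebesgue_integral lborel ({0..pi} \<times> {0..2 * pi}) (\<lambda>a::real \<times> real. C * sin (fst a)) = 4 * pi * C" .
qed

text \<open>
  A field \<open>\<kappa> x\<close> has constant normal component \<open>\<kappa> r\<close> on the sphere of radius \<open>r\<close>, so its flux is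
  \<open>\<kappa> r\<close> times the area \<open>4 \<pi> r\<^sup>2\<close>. Integrability comes for free because the integrand is a
  constant multiple of \<open>sin s\<close>.
\<close>

lemma flux_radial:
  assumes r: "r > 0"
    and J: "\<And>p j. radius p = r \<Longrightarrow> J j p = \<kappa> * p $ Some j"
  shows "flux_integrable J r" and "flux J r = 4 * pi * r ^ 3 * \<kappa>"
proof -
  have "flux_integrand J r a = (r ^ 3 * \<kappa>) * sin (fst a)" for a
  proof -
    let ?x = "sphere_point r a"
    have "(\<Sum>j\<in>UNIV. J j (at_time_zero ?x) * (?x $ j / r)) = \<kappa> / r * (\<Sum>j\<in>UNIV. (?x $ j)\<^sup>2)"
      using r by (simp add: J radius_at_time_zero norm_sphere_point at_time_zero_Some
          sum_distrib_left power2_eq_square mult_ac)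
    also have "(\<Sum>j\<in>UNIV. (?x $ j)\<^sup>2) = (norm ?x)\<^sup>2"
      by (simp add: norm_vec_def L2_set_def sum_nonneg)
    also have "\<kappa> / r * (norm ?x)\<^sup>2 = \<kappa> * r"
      using r by (simp add: norm_sphere_point power2_eq_square)
    finally show ?thesis
      by (simp add: flux_integrand_def Let_def power2_eq_square power3_eq_cube)
  qed
  then have "flux_integrand J r = (\<lambda>a. (r ^ 3 * \<kappa>) * sin (fst a))" ..
  then show "flux_integrable J r" and "flux J r = 4 * pi * r ^ 3 * \<kappa>"
    using integral_sin_rectangle by (simp_all add: flux_integrable_def flux_def)
qed

section \<open>Components of the static metric in rectangular coordinates\<close>

lemma partial_time_coord: "partial \<mu> time_coord p = (if \<mu> = None then 1 else 0)"
  by (rule has_partial_imp_partial)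
    (use has_partial_coordinate[of \<mu> None p] in \<open>auto simp: time_coord_def [abs_def]\<close>)

lemma radius_on_time_line: "radius (p + s *\<^sub>R axis None 1) = radius p"
  by (simp add: radius_alt axis_def)

lemma partial_time_radius: "partial None radius p = 0"
  by (simp add: partial_def radius_on_time_line)

lemma angle_nth: "angle q $ a = q $ Some a / radius q"
  by (simp add: angle_def sgn_div_norm radius_def space_part_def divide_inverse)

lemma partial_time_angle: "partial None (\<lambda>q. angle q $ a) p = 0"
  by (simp add: partial_def angle_nth radius_on_time_line) (simp add: axis_def)

lemma partial_space_angle:
  assumes "radius p > 0"
  shows "partial (Some i) (\<lambda>q. angle q $ a) p =
    (if a = i then 1 else 0) / radius p - p $ Some i * p $ Some a / radius p ^ 3"
proof (rule has_partial_imp_partial)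
  note rad = has_partial_radius[OF assms, of i, unfolded has_partial_def]
  note coord = has_partial_coordinate[of "Some i" "Some a" p, unfolded has_partial_def]
  show "has_partial (Some i) (\<lambda>q. angle q $ a)
    ((if a = i then 1 else 0) / radius p - p $ Some i * p $ Some a / radius p ^ 3) p"
    unfolding angle_nth has_partial_def
    by (rule DERIV_cong[OF DERIV_divide[OF coord rad]])
       (use assms in \<open>auto simp: field_simps power2_eq_square power3_eq_cube\<close>)
qed

text \<open>
  The Gram matrix \<open>\<Sum>\<^sub>a d\<theta>\<^sup>a d\<theta>\<^sup>a\<close> of the angle map is \<open>1/r\<^sup>2\<close> times the projection orthogonal to
  the radial direction. So \<open>r\<^sup>2 g\<^sub>S\<^sup>2\<close> is the Euclidean metric without its radial part
  \<open>x\<^sub>i x\<^sub>j / r\<^sup>2\<close>, and the radial term of the metric puts that part back with weight \<open>1/N\<^sup>2\<close>.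
\<close>

lemma spatial_static_metric:
  assumes "radius p > 0"
  shows "spatial_metric (static_metric N2) i j p =
    (if i = j then 1 else 0) + (1 / N2 (radius p) - 1) / (radius p)\<^sup>2 * p $ Some i * p $ Some j"
proof -
  let ?r = "radius p" and ?x = "\<lambda>i. p $ Some i"
  define d where "d = (\<lambda>i j::3. if i = j then 1 else 0::real)"
  have delta: "(\<Sum>a\<in>UNIV. d a i * h a) = h i" for h i
    by (simp add: d_def if_distribR if_distrib cong: if_cong)
  have expand: "(u / ?r - ?x i * y / ?r ^ 3) * (v / ?r - ?x j * y / ?r ^ 3)
      = u * (v / ?r\<^sup>2) - u * (?x j * y / ?r ^ 4) - v * (?x i * y / ?r ^ 4)
        + y\<^sup>2 * (?x i * ?x j / ?r ^ 6)" for u v y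
    using assms by (simp add: field_simps eval_nat_numeral)
  have "(\<Sum>a\<in>UNIV. (d a i / ?r - ?x i * ?x a / ?r ^ 3) * (d a j / ?r - ?x j * ?x a / ?r ^ 3))
     = d i j / ?r\<^sup>2 - ?x j * ?x i / ?r ^ 4 - ?x i * ?x j / ?r ^ 4
      + ?r\<^sup>2 * (?x i * ?x j / ?r ^ 6)"
    unfolding expand sum.distrib sum_subtractf delta radius_sq sum_distrib_right ..
  also have "\<dots> = d i j / ?r\<^sup>2 - ?x i * ?x j / ?r ^ 4"
    using assms by (simp add: field_simps eval_nat_numeral)
  finally have "spatial_metric (static_metric N2) i j p =
      1 / N2 ?r * (?x i / ?r) * (?x j / ?r) + ?r\<^sup>2 * (d i j / ?r\<^sup>2 - ?x i * ?x j / ?r ^ 4)"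
    using assms
    by (simp add: spatial_metric_def static_metric_def partial_time_coord partial_space_angle
        has_partial_imp_partial[OF has_partial_radius] d_def)
  also have "\<dots> = d i j + (1 / N2 ?r - 1) / ?r\<^sup>2 * ?x i * ?x j"
    using assms by (simp add: divide_simps) (simp add: algebra_simps eval_nat_numeral)
  finally show ?thesis
    by (simp add: d_def)
qed

lemma shift_static_metric: "shift (static_metric N2) i p = 0"
  by (simp add: shift_def static_metric_def partial_time_coord partial_time_radius partial_time_angle)

lemma lapse_sq_static_metric: "lapse_sq (static_metric N2) p = N2 (radius p)"
  by (simp add: lapse_sq_def Let_def shift_static_metric)
    (simp add: static_metric_def partial_time_coord partial_time_radius partial_time_angle)

lemma partial_zero: "partial i (\<lambda>q. 0) p = 0"
  by (simp add: partial_def)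


section \<open>Energy densities of the static metric\<close>

text \<open>
  With \<open>\<phi> = f / r\<^sup>2\<close>, the density is the gradient of \<open>- 2 r\<^sup>2 \<phi>1 - 6 \<phi>\<close>, computed with
  \<open>\<partial>\<^sub>j r\<^sup>2 = 2 x\<^sub>j\<close>.
\<close>

lemma density1_static_metric:
  assumes c: "radial_chain rs (\<lambda>\<rho>. (1 / N2 \<rho> - 1) / \<rho>\<^sup>2) \<phi>1"
      "radial_chain rs \<phi>1 \<phi>2" "radial_chain rs \<phi>2 \<phi>3"
    and rs: "0 \<le> rs" and p: "p \<in> exterior_region rs"
  shows "density1 (static_metric N2) j p =
    (- 10 * \<phi>1 (radius p) - 2 * (radius p)\<^sup>2 * \<phi>2 (radius p)) * p $ Some j"
proof -
  define \<phi> where "\<phi> = (\<lambda>\<rho>. (1 / N2 \<rho> - 1) / \<rho>\<^sup>2)"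
  note c = c[folded \<phi>_def]
  let ?G = "static_metric N2" and ?H = "radial_hess \<phi> \<phi>1 \<phi>2"
  have pos: "radius q > 0" if "q \<in> exterior_region rs" for q
    using that rs by (simp add: exterior_region_def)
  have "dx k (dx l (spatial_metric ?G a b)) q = ?H k l a b q" if "q \<in> exterior_region rs" for q k l a b
    by (rule partial_partial_radial_tensor[OF c(1,2) rs that, of _ "if a = b then 1 else 0"])
      (simp add: spatial_static_metric pos \<phi>_def)
  then have "dx j (dx k (dx l (spatial_metric ?G a b))) p = dx j (?H k l a b) p" for k l a b
    by (rule partial_cong_open[OF open_exterior_region p])
  then have "has_partial (Some j)
      (\<lambda>q. (\<Sum>i\<in>UNIV. \<Sum>a\<in>UNIV. ?H i i a a q) - (\<Sum>u\<in>UNIV. \<Sum>i\<in>UNIV. ?H u i u i q))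
      (density1 ?G j p) p"
    unfolding density1_def
    by (simp only:) (intro has_partial_minus has_partial_sum has_partial_radial_hess[OF c rs p])
  moreover have "has_partial (Some j) (\<lambda>q. - 2 * (radius q)\<^sup>2 * \<phi>1 (radius q) - 6 * \<phi> (radius q))
      ((- 10 * \<phi>1 (radius p) - 2 * (radius p)\<^sup>2 * \<phi>2 (radius p)) * p $ Some j) p"
    using pos[OF p] unfolding has_partial_def
    by (auto intro!: derivative_eq_intros has_partial_radius[OF pos[OF p], unfolded has_partial_def]
        c(1,2)[THEN has_partial_radial, OF rs p, unfolded has_partial_def]
        simp: field_simps power2_eq_square)
  ultimately show ?thesis
    unfolding radial_hess_contraction by (rule has_partial_unique)
qed

text \<open>
  The Laplacian of a radial function \<open>\<nu>\<close> is \<open>r\<^sup>2 \<nu>2 + 3 \<nu>1\<close>; the density is its gradient.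
\<close>

lemma density4_static_metric:
  assumes c: "radial_chain rs N2 \<nu>1" "radial_chain rs \<nu>1 \<nu>2" "radial_chain rs \<nu>2 \<nu>3"
    and rs: "0 \<le> rs" and p: "p \<in> exterior_region rs"
  shows "density4 (static_metric N2) j p =
    (5 * \<nu>2 (radius p) + (radius p)\<^sup>2 * \<nu>3 (radius p)) * p $ Some j"
proof -
  have pos: "radius p > 0"
    using p rs by (simp add: exterior_region_def)
  define L where "L = (\<lambda>i q. \<nu>2 (radius q) * q $ Some i * q $ Some i + \<nu>1 (radius q))"
  have "dx i (dx i (lapse_sq (static_metric N2))) q = L i q" if "q \<in> exterior_region rs" for q i
    using partial_partial_radial[OF c(1,2) rs that, of "lapse_sq (static_metric N2)" i i]
    by (simp add: lapse_sq_static_metric L_def)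
  then have "dx j (dx i (dx i (lapse_sq (static_metric N2)))) p = dx j (L i) p" for i
    by (rule partial_cong_open[OF open_exterior_region p])
  moreover
  note rad = c[THEN has_partial_radial, OF rs p, unfolded has_partial_def]
  have "has_partial (Some j) (L i) (dx j (L i) p) p" for i
  proof -
    have "\<exists>d. has_partial (Some j) (L i) d p"
      unfolding has_partial_def L_def
      by (rule exI)
        (rule DERIV_add DERIV_mult rad has_partial_coordinate[unfolded has_partial_def])+
    then show ?thesis
      using has_partial_imp_partial by blast
  qed
  ultimately have "has_partial (Some j) (\<lambda>q. \<Sum>i\<in>UNIV. L i q) (density4 (static_metric N2) j p) p"
    unfolding density4_def by (simp only:) (rule has_partial_sum)
  moreover have "(\<lambda>q. \<Sum>i\<in>UNIV. L i q) = (\<lambda>q. (radius q)\<^sup>2 * \<nu>2 (radius q) + 3 * \<nu>1 (radius q))"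
    unfolding radius_sq by (simp add: L_def sum_3 algebra_simps power2_eq_square)
  moreover have "has_partial (Some j) (\<lambda>q. (radius q)\<^sup>2 * \<nu>2 (radius q) + 3 * \<nu>1 (radius q))
      ((5 * \<nu>2 (radius p) + (radius p)\<^sup>2 * \<nu>3 (radius p)) * p $ Some j) p"
    using pos unfolding has_partial_def
    by (auto intro!: derivative_eq_intros has_partial_radius[OF pos, unfolded has_partial_def] rad
        simp: field_simps power2_eq_square)
  ultimately show ?thesis
    by (simp only:) (rule has_partial_unique)
qed

lemma dt_spatial_static_metric:
  assumes "0 \<le> rs" and p: "p \<in> exterior_region rs"
  shows "dt (spatial_metric (static_metric N2) i j) p = 0"
proof -
  have "radius p > 0"
    using assms by (simp add: exterior_region_def)
  then show ?thesis
    by (simp add: partial_def spatial_static_metric radius_on_time_line) (simp add: axis_def)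
qed

lemma time_densities_vanish:
  assumes rs: "0 \<le> rs" and p: "p \<in> exterior_region rs"
  shows "density2 (static_metric N2) j p = 0" and "density3 (static_metric N2) j p = 0"
    and "density5 (static_metric N2) j p = 0" and "density6 (static_metric N2) j p = 0"
proof -
  let ?G = "static_metric N2"
  have zero: "partial \<mu> f q = 0" if "\<And>q. q \<in> exterior_region rs \<Longrightarrow> f q = 0" "q \<in> exterior_region rs"
    for \<mu> q and f :: "spacetime \<Rightarrow> real"
    using partial_cong_open[OF open_exterior_region that(2), of f "\<lambda>_. 0"] that(1)
    by (simp add: partial_zero)
  have "dt (dt (spatial_metric ?G i k)) q = 0" if "q \<in> exterior_region rs" for i k q
    by (rule zero[OF _ that]) (rule dt_spatial_static_metric[OF rs])
  then have "dx l (dt (dt (spatial_metric ?G i k))) p = 0" for i k l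
    by (rule zero[OF _ p])
  then show "density2 ?G j p = 0" and "density5 ?G j p = 0"
    by (simp_all add: density2_def density5_def)
  have "shift ?G = (\<lambda>i q. 0)"
    by (intro ext) (rule shift_static_metric)
  then show "density3 ?G j p = 0" and "density6 ?G j p = 0"
    by (simp_all add: density3_def density6_def partial_zero[abs_def])
qed

text \<open>
  Iterating \<open>D\<close> on \<open>f / \<rho>\<^sup>2\<close> in terms of the ordinary derivatives of \<open>f\<close>.
\<close>

lemma radial_chain_div_square:
  assumes rs: "0 \<le> rs"
    and d: "\<And>\<rho>. \<rho> > rs \<Longrightarrow> (f has_real_derivative f1 \<rho>) (at \<rho>)"
      "\<And>\<rho>. \<rho> > rs \<Longrightarrow> (f1 has_real_derivative f2 \<rho>) (at \<rho>)"
      "\<And>\<rho>. \<rho> > rs \<Longrightarrow> (f2 has_real_derivative f3 \<rho>) (at \<rho>)"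
  shows "radial_chain rs (\<lambda>\<rho>. f \<rho> / \<rho>\<^sup>2) (\<lambda>\<rho>. f1 \<rho> / \<rho> ^ 3 - 2 * f \<rho> / \<rho> ^ 4)"
    and "radial_chain rs (\<lambda>\<rho>. f1 \<rho> / \<rho> ^ 3 - 2 * f \<rho> / \<rho> ^ 4)
      (\<lambda>\<rho>. f2 \<rho> / \<rho> ^ 4 - 5 * f1 \<rho> / \<rho> ^ 5 + 8 * f \<rho> / \<rho> ^ 6)"
    and "radial_chain rs (\<lambda>\<rho>. f2 \<rho> / \<rho> ^ 4 - 5 * f1 \<rho> / \<rho> ^ 5 + 8 * f \<rho> / \<rho> ^ 6)
      (\<lambda>\<rho>. f3 \<rho> / \<rho> ^ 5 - 9 * f2 \<rho> / \<rho> ^ 6 + 33 * f1 \<rho> / \<rho> ^ 7 - 48 * f \<rho> / \<rho> ^ 8)"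
  unfolding radial_chain_def
  using rs by (auto intro!: derivative_eq_intros d simp: field_simps eval_nat_numeral)

text \<open>
  With \<open>f = 1/N\<^sup>2 - 1\<close> the first flux is \<open>8 \<pi> (2 f / r - r f'')\<close>; the subtracted bracket is \<open>f''\<close>
  written out. The fourth flux is independent of \<open>r\<close> and carries the energy.
\<close>

lemma flux_densities_static_metric:
  fixes N2 :: "real \<Rightarrow> real"
  assumes rs: "0 \<le> rs" and r: "r > rs"
    and N2: "\<And>r. N2 r = c1 - m / r + c2 * r"
    and pos: "\<And>r. r > rs \<Longrightarrow> N2 r > 0"
  shows "\<And>J. J \<in> {density1 (static_metric N2), density2 (static_metric N2), density3 (static_metric N2),
      density4 (static_metric N2), density5 (static_metric N2), density6 (static_metric N2)} \<Longrightarrow>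
      flux_integrable J r"
    and "flux (density1 (static_metric N2)) r =
      8 * pi * (2 * (1 / N2 r - 1) / r - r * (2 * m / (r ^ 3 * (N2 r)\<^sup>2) + 2 * (m / r\<^sup>2 + c2)\<^sup>2 / N2 r ^ 3))"
    and "flux (density4 (static_metric N2)) r = - 8 * pi * c2"
    and "flux (density2 (static_metric N2)) r = 0" and "flux (density3 (static_metric N2)) r = 0"
    and "flux (density5 (static_metric N2)) r = 0" and "flux (density6 (static_metric N2)) r = 0"
proof -
  let ?G = "static_metric N2"
  define n1 where "n1 = (\<lambda>\<rho>. m / \<rho>\<^sup>2 + c2)"
  define f where "f = (\<lambda>\<rho>. 1 / N2 \<rho> - 1)"
  \<comment> \<open>\<open>n1\<close> is the derivative of \<open>N2\<close>; \<open>f1\<close>, \<open>f2\<close>, \<open>f3\<close> are the derivatives of \<open>f\<close>.\<close>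
  define f1 where "f1 = (\<lambda>\<rho>. - n1 \<rho> / (N2 \<rho>)\<^sup>2)"
  define f2 where "f2 = (\<lambda>\<rho>. 2 * m / \<rho> ^ 3 / (N2 \<rho>)\<^sup>2 + 2 * (n1 \<rho>)\<^sup>2 / N2 \<rho> ^ 3)"
  define f3 where "f3 = (\<lambda>\<rho>. - 6 * m / \<rho> ^ 4 / (N2 \<rho>)\<^sup>2 - 12 * m * n1 \<rho> / \<rho> ^ 3 / N2 \<rho> ^ 3
    - 6 * n1 \<rho> ^ 3 / N2 \<rho> ^ 4)"
  have r0: "r > 0" using rs r by simp
  have N2': "(N2 has_real_derivative n1 \<rho>) (at \<rho>)" if "\<rho> > rs" for \<rho>
    unfolding N2 [abs_def] n1_def using that rs
    by (auto intro!: derivative_eq_intros simp: power2_eq_square)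
  have n1': "(n1 has_real_derivative - 2 * m / \<rho> ^ 3) (at \<rho>)" if "\<rho> > rs" for \<rho>
    unfolding n1_def using that rs
    by (auto intro!: derivative_eq_intros simp: field_simps eval_nat_numeral)
  have f: "(f has_real_derivative f1 \<rho>) (at \<rho>)" if "\<rho> > rs" for \<rho>
    unfolding f_def f1_def using pos[OF that]
    by (auto intro!: derivative_eq_intros N2'[OF that] simp: field_simps power2_eq_square)
  have f1: "(f1 has_real_derivative f2 \<rho>) (at \<rho>)" if "\<rho> > rs" for \<rho>
    unfolding f1_def f2_def using pos[OF that] rs that
    by (auto intro!: derivative_eq_intros N2'[OF that] n1'[OF that]
        simp: field_simps eval_nat_numeral)
  have f2: "(f2 has_real_derivative f3 \<rho>) (at \<rho>)" if "\<rho> > rs" for \<rho>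
    unfolding f2_def f3_def using pos[OF that] rs that
    by (auto intro!: derivative_eq_intros N2'[OF that] n1'[OF that]
        simp: field_simps eval_nat_numeral)
  note chain = radial_chain_div_square[OF rs f f1 f2]
  have in_region: "p \<in> exterior_region rs" if "radius p = r" for p
    using that r by (simp add: exterior_region_def)

  have "- 10 * (a1 / r ^ 3 - 2 * a / r ^ 4) - 2 * r\<^sup>2 * (a2 / r ^ 4 - 5 * a1 / r ^ 5 + 8 * a / r ^ 6)
      = 4 * a / r ^ 4 - 2 * a2 / r\<^sup>2" for a a1 a2
    using r0 by (simp add: field_simps eval_nat_numeral)
  then have d1: "density1 ?G j p = (4 * f r / r ^ 4 - 2 * f2 r / r\<^sup>2) * p $ Some j" if "radius p = r" for p j
    using density1_static_metric[OF chain[unfolded f_def] rs in_region[OF that], of j] that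
    by (simp only: f_def)

  \<comment> \<open>The iterates of \<open>D\<close> on \<open>N\<^sup>2\<close> for the second flux that survives.\<close>
  have nu: "radial_chain rs N2 (\<lambda>\<rho>. m / \<rho> ^ 3 + c2 / \<rho>)"
    "radial_chain rs (\<lambda>\<rho>. m / \<rho> ^ 3 + c2 / \<rho>) (\<lambda>\<rho>. - 3 * m / \<rho> ^ 5 - c2 / \<rho> ^ 3)"
    "radial_chain rs (\<lambda>\<rho>. - 3 * m / \<rho> ^ 5 - c2 / \<rho> ^ 3) (\<lambda>\<rho>. 15 * m / \<rho> ^ 7 + 3 * c2 / \<rho> ^ 5)"
    unfolding radial_chain_def N2 [abs_def] using rs
    by (auto intro!: derivative_eq_intros simp: field_simps eval_nat_numeral)
  have "5 * (- 3 * m / r ^ 5 - c2 / r ^ 3) + r\<^sup>2 * (15 * m / r ^ 7 + 3 * c2 / r ^ 5) = - 2 * c2 / r ^ 3"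
    using r0 by (simp add: field_simps eval_nat_numeral)
  then have d4: "density4 ?G j p = (- 2 * c2 / r ^ 3) * p $ Some j" if "radius p = r" for p j
    using density4_static_metric[OF nu rs in_region[OF that], of j] that by simp

  have d0: "density2 ?G j p = 0 * p $ Some j" "density3 ?G j p = 0 * p $ Some j"
    "density5 ?G j p = 0 * p $ Some j" "density6 ?G j p = 0 * p $ Some j" if "radius p = r" for p j
    using time_densities_vanish[OF rs in_region[OF that], of N2 j] by simp_all

  note fl = flux_radial(1)[OF r0] and flv = flux_radial(2)[OF r0]
  have integrable: "flux_integrable (density1 ?G) r" "flux_integrable (density2 ?G) r"
      "flux_integrable (density3 ?G) r" "flux_integrable (density4 ?G) r"
      "flux_integrable (density5 ?G) r" "flux_integrable (density6 ?G) r"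
    by (rule fl, erule d1 d0 d4)+
  show "flux_integrable J r"
    if "J \<in> {density1 ?G, density2 ?G, density3 ?G, density4 ?G, density5 ?G, density6 ?G}" for J
    using that integrable by (auto simp only: insert_iff empty_iff)
  show "flux (density2 ?G) r = 0" "flux (density3 ?G) r = 0" "flux (density5 ?G) r = 0" "flux (density6 ?G) r = 0"
    using flv[of "density2 ?G", OF d0(1)] flv[of "density3 ?G", OF d0(2)]
      flv[of "density5 ?G", OF d0(3)] flv[of "density6 ?G", OF d0(4)] by simp_all
  show "flux (density4 ?G) r = - 8 * pi * c2"
    using flv[of "density4 ?G", OF d4] r0 by simp
  have "flux (density1 ?G) r = 4 * pi * r ^ 3 * (4 * f r / r ^ 4 - 2 * f2 r / r\<^sup>2)"
    by (rule flv[of "density1 ?G", OF d1])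
  also have "\<dots> = 8 * pi * (2 * f r / r - r * f2 r)"
    using r0 by (simp add: field_simps eval_nat_numeral)
  finally show "flux (density1 ?G) r =
      8 * pi * (2 * (1 / N2 r - 1) / r - r * (2 * m / (r ^ 3 * (N2 r)\<^sup>2) + 2 * (m / r\<^sup>2 + c2)\<^sup>2 / N2 r ^ 3))"
    by (simp add: f_def f2_def n1_def)
qed

section \<open>Behaviour at infinity\<close>

text \<open>
  If \<open>c\<^sub>2 > 0\<close> then \<open>1/N\<^sup>2\<close> decays like \<open>1/r\<close>; if \<open>c\<^sub>2 = 0\<close> then \<open>1/N\<^sup>2\<close> is bounded and the
  derivative of \<open>N\<^sup>2\<close> decays like \<open>1/r\<^sup>2\<close>. Either way both terms vanish at infinity.
\<close>

lemma flux_density1_limit: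
  fixes c1 c2 m :: real
  assumes m: "m \<ge> 0" and "c2 > 0 \<or> c2 = 0 \<and> c1 > 0"
  shows "((\<lambda>r. 8 * pi * (2 * (1 / (c1 - m / r + c2 * r) - 1) / r
     - r * (2 * m / (r ^ 3 * (c1 - m / r + c2 * r)\<^sup>2)
            + 2 * (m / r\<^sup>2 + c2)\<^sup>2 / (c1 - m / r + c2 * r) ^ 3))) \<longlongrightarrow> 0) at_top"
  using assms(2)
proof
  assume "c2 > 0"
  then show ?thesis by real_asymp
next
  assume "c2 = 0 \<and> c1 > 0"
  then have "c2 = 0" and "c1 > 0" by auto
  have "((\<lambda>r. 8 * pi * (2 * (1 / (c1 - m / r) - 1) / r
     - (2 * m / (r\<^sup>2 * (c1 - m / r)\<^sup>2) + 2 * m\<^sup>2 / (r ^ 3 * (c1 - m / r) ^ 3)))) \<longlongrightarrow> 0) at_top"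
    \<comment> \<open>The asymptotic expansion has to know whether the terms with the factor \<open>m\<close> are present.\<close>
  proof (cases "m = 0")
    case True
    then show ?thesis by simp real_asymp
  next
    case False
    then have "m > 0" using m by simp
    then show ?thesis using \<open>c1 > 0\<close> by real_asymp
  qed
  moreover have "\<forall>\<^sub>F r in at_top. 8 * pi * (2 * (1 / (c1 - m / r) - 1) / r
     - (2 * m / (r\<^sup>2 * (c1 - m / r)\<^sup>2) + 2 * m\<^sup>2 / (r ^ 3 * (c1 - m / r) ^ 3)))
    = 8 * pi * (2 * (1 / (c1 - m / r + c2 * r) - 1) / r
     - r * (2 * m / (r ^ 3 * (c1 - m / r + c2 * r)\<^sup>2)
            + 2 * (m / r\<^sup>2 + c2)\<^sup>2 / (c1 - m / r + c2 * r) ^ 3))"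
    using eventually_gt_at_top[of 0] unfolding \<open>c2 = 0\<close>
    by eventually_elim (simp add: distrib_left power_divide eval_nat_numeral)
  ultimately show ?thesis
    by (rule Lim_transform_eventually)
qed

text \<open>
  A negative \<open>c\<^sub>2\<close> drives \<open>N\<^sup>2\<close> to \<open>-\<infinity>\<close>. When \<open>c\<^sub>2 = 0\<close>, the mass term only lowers \<open>N\<^sup>2\<close>, so
  \<open>c\<^sub>1\<close> alone has to keep it positive.
\<close>

lemma positive_lapse_parameters:
  fixes c1 c2 m :: real
  assumes "m \<ge> 0" and pos: "\<And>r. r > rs \<Longrightarrow> c1 - m / r + c2 * r > 0"
  shows "c2 > 0 \<or> c2 = 0 \<and> c1 > 0"
proof (rule ccontr)
  assume neg: "\<not> ?thesis"
  have ev: "\<forall>\<^sub>F r in at_top. c1 - m / r + c2 * r > 0"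
    using eventually_gt_at_top[of rs] by eventually_elim (rule pos)
  show False
  proof (cases "c2 = 0")
    case True
    with neg have "c1 \<le> 0" by simp
    define r where "r = max rs 0 + 1"
    have "c1 - m / r > 0"
      using pos[of r] True by (simp add: r_def)
    moreover have "m / r \<ge> 0"
      using assms(1) by (simp add: r_def)
    ultimately show False using \<open>c1 \<le> 0\<close> by simp
  next
    case False
    with neg have "c2 < 0" by simp
    then have "filterlim (\<lambda>r. c1 - m / r + c2 * r) at_bot at_top"
      by real_asymp
    then have "\<forall>\<^sub>F r in at_top. c1 - m / r + c2 * r < 0"
      by (simp add: filterlim_at_bot_dense)
    with ev have "\<forall>\<^sub>F r :: real in at_top. False" by eventually_elim simp
    then show False by simp
  qed
qed

theorem theorem1:
  fixes \<alpha> \<beta> c1 c2 m rs :: real and N2 :: "real \<Rightarrow> real"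
  assumes beta: "\<beta> = - 3 * \<alpha>"
    and m: "m \<ge> 0"
    and rs: "rs > 0"
    and N2: "\<And>r. N2 r = c1 - m / r + c2 * r"
    and pos: "\<And>r. r > rs \<Longrightarrow> N2 r > 0"
    and A_flat: "A_flat_on \<alpha> \<beta> (exterior_region rs) (static_metric N2)"
  shows "energy_well_defined \<alpha> \<beta> (static_metric N2) \<and>
         energy \<alpha> \<beta> (static_metric N2) = 8 * pi * \<alpha> * c2"
proof -
  let ?G = "static_metric N2"
  define \<Phi> where "\<Phi> = (\<lambda>r. 8 * pi * (2 * (1 / N2 r - 1) / r
    - r * (2 * m / (r ^ 3 * (N2 r)\<^sup>2) + 2 * (m / r\<^sup>2 + c2)\<^sup>2 / N2 r ^ 3)))"
  note flux = flux_densities_static_metric[OF less_imp_le[OF rs] _ N2 pos]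
  have large: "\<forall>\<^sub>F r in at_top. r > rs"
    by (rule eventually_gt_at_top)
  have "c2 > 0 \<or> c2 = 0 \<and> c1 > 0"
    using m pos unfolding N2 by (rule positive_lapse_parameters)
  then have "(\<Phi> \<longlongrightarrow> 0) at_top"
    unfolding \<Phi>_def N2 by (rule flux_density1_limit[OF m])
  then have "((\<lambda>r. - 5 / 2 * \<alpha> * \<Phi> r + 8 * pi * \<alpha> * c2) \<longlongrightarrow> - 5 / 2 * \<alpha> * 0 + 8 * pi * \<alpha> * c2) at_top"
    by (intro tendsto_intros)
  moreover have "\<forall>\<^sub>F r in at_top. - 5 / 2 * \<alpha> * \<Phi> r + 8 * pi * \<alpha> * c2 = energy_at_radius \<alpha> \<beta> ?G r"
    using large
    by eventually_elim (simp add: energy_at_radius_def flux(2-7) \<Phi>_def beta algebra_simps)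
  ultimately have lim: "(energy_at_radius \<alpha> \<beta> ?G \<longlongrightarrow> 8 * pi * \<alpha> * c2) at_top"
    using Lim_transform_eventually by fastforce
  have "\<forall>\<^sub>F r in at_top. \<forall>J \<in> {density1 ?G, density2 ?G, density3 ?G, density4 ?G, density5 ?G, density6 ?G}.
      flux_integrable J r"
    using large by eventually_elim (intro ballI flux(1))
  with lim have "energy_well_defined \<alpha> \<beta> ?G"
    unfolding energy_well_defined_def by blast
  moreover have "energy \<alpha> \<beta> ?G = 8 * pi * \<alpha> * c2"
    unfolding energy_def using lim by (intro tendsto_Lim) simp_all
  ultimately show ?thesis ..
qed

end
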